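(* If $D$ is a digraph with $d$ vertices and complement $D'$, then $C(D';i,j)=(-1)^d\,C(D;-i-j,\,j)$ (as polynomials in $i$ and $j$).
   Context: A digraph is a finite labelled directed graph without multiple edges, possibly with loops and with bidirected edges. The complement $D'$ of $D$ is the digraph on the same vertex set whose edges are precisely the ordered pairs $(u,v)$ of vertices (including $u=v$) that are not edges of $D$. A path-cycle cover of $D$ is a subset $S$ of the edges of $D$ no two of which share their initial vertex and no two of which share their terminal vertex; equivalently the spanning subgraph with edge set $S$ is a vertex-disjoint union of directed paths and directed cycles (isolated vertices are directed paths with no edges; loops are cycles of length one). $\pi(S)$ is the set of vertex sets of the directed paths, $\sigma(S)$ is the set of vertex sets of the directed cycles, and $\ell$ denotes the number of blocks. With $i^{\underline k}=i(i-1)\cdots(i-k+1)$, the cover polynomial of $D$ is $$C(D;i,j)=\sum_S i^{\underline{\ell(\pi(S))}}\,j^{\ell(\sigma(S))},$$ the sum over all path-cycle covers $S$ of $D$. *)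

theory Defs
  imports
    "Graph_Theory.Pair_Digraph"
    "HOL-Computational_Algebra.Polynomial"
begin

definition digraph_complement :: "'a pair_pre_digraph \<Rightarrow> 'a pair_pre_digraph" where
  "digraph_complement D =
     \<lparr>pverts = pverts D, parcs = pverts D \<times> pverts D - parcs D\<rparr>"

definition path_cycle_cover :: "'a pair_pre_digraph \<Rightarrow> ('a \<times> 'a) set \<Rightarrow> bool" where
  "path_cycle_cover D S \<longleftrightarrow> S \<subseteq> parcs D \<and> inj_on fst S \<and> inj_on snd S"

definition spanning_subgraph :: "'a pair_pre_digraph \<Rightarrow> ('a \<times> 'a) set \<Rightarrow> 'a pair_pre_digraph" where
  "spanning_subgraph D S = \<lparr>pverts = pverts D, parcs = S\<rparr>"

definition incident_arcs :: "('a \<times> 'a) set \<Rightarrow> 'a set \<Rightarrow> ('a \<times> 'a) set" where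
  "incident_arcs S B = {e \<in> S. fst e \<in> B \<or> snd e \<in> B}"

text \<open>
  A block is the vertex set of a connected component of the spanning subgraph with arc set
  \<open>S\<close>: the component is the path (or cycle) \<open>p\<close> exactly if \<open>p\<close> uses all arcs of \<open>S\<close> incident
  with its vertices. The empty walk gives the isolated vertices, and a loop is a cycle.
\<close>

definition path_blocks :: "'a pair_pre_digraph \<Rightarrow> ('a \<times> 'a) set \<Rightarrow> 'a set set" where
  "path_blocks D S =
     {set (pawalk_verts u p) | u p.
        (\<exists>v. pre_digraph.apath (with_proj (spanning_subgraph D S)) u p v) \<and>
        incident_arcs S (set (pawalk_verts u p)) = set p}"

definition cycle_blocks :: "'a pair_pre_digraph \<Rightarrow> ('a \<times> 'a) set \<Rightarrow> 'a set set" where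
  "cycle_blocks D S =
     {set (pawalk_verts u p) | u p.
        pre_digraph.awalk (with_proj (spanning_subgraph D S)) u p u \<and>
        pre_digraph.cycle (with_proj (spanning_subgraph D S)) p \<and>
        incident_arcs S (set (pawalk_verts u p)) = set p}"

definition falling_factorial :: "'a::comm_ring_1 \<Rightarrow> nat \<Rightarrow> 'a" where
  "falling_factorial x k = (\<Prod>m<k. x - of_nat m)"

text \<open>
  The polynomial ring in \<open>i\<close> and \<open>j\<close> over the integers is represented as \<open>int poly poly\<close>:
  \<open>i\<close> is the outer indeterminate and \<open>j\<close> the inner one. Hence \<open>pcompose P Q\<close> substitutes \<open>Q\<close>
  for \<open>i\<close> in \<open>P\<close> and leaves \<open>j\<close> unchanged.
\<close>

definition var_i :: "int poly poly" where
  "var_i = [:0, 1:]"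

definition var_j :: "int poly poly" where
  "var_j = [:[:0, 1:]:]"

definition cover_polynomial :: "'a pair_pre_digraph \<Rightarrow> int poly poly" where
  "cover_polynomial D =
     (\<Sum>S \<in> {S. path_cycle_cover D S}.
        falling_factorial var_i (card (path_blocks D S)) * var_j ^ card (cycle_blocks D S))"

end

theory Submission imports Defs begin

text \<open>
  A path-cycle cover is a partial injection \<open>S\<close> of the vertex set \<open>V\<close> into itself. Its paths
  correspond to their final vertices, which are the vertices without an outgoing arc, so there are
  \<open>d - |S|\<close> of them. Hence \<open>S\<close> contributes
  \<open>w x S = falling_factorial x (d - |S|) * j ^ c(S)\<close> at \<open>x = i\<close>, where \<open>c(S)\<close> is its number of
  cycles.

  The covers of the complement of \<open>D\<close> are the partial injections \<open>S\<close> of \<open>V\<close> that avoid the arc set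
  \<open>E\<close> of \<open>D\<close>. Inclusion-exclusion over the subsets \<open>T\<close> of \<open>S \<inter> E\<close> turns the sum of their weights
  into the sum, over the covers \<open>T\<close> of \<open>D\<close>, of \<open>(-1) ^ |T|\<close> times the total weight of all partial
  injections \<open>S \<supseteq> T\<close> of \<open>V\<close>. That total can be evaluated in closed form (\<open>sum_supersets\<close>): contracting
  the \<open>k = d - |T|\<close> paths of \<open>T\<close> to points shows that it is \<open>j ^ c(T)\<close> times the cover polynomial of
  the complete digraph with loops on \<open>k\<close> vertices, which is the rising factorial
  \<open>(i + j) (i + j + 1) \<dots> (i + j + k - 1)\<close>, that is \<open>(-1) ^ k\<close> times the falling factorial of
  \<open>- i - j\<close>. The signs \<open>(-1) ^ |T|\<close> and \<open>(-1) ^ k\<close> combine to \<open>(-1) ^ d\<close>, and what remains is the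
  sum of \<open>w (- i - j) T\<close> over the covers \<open>T\<close> of \<open>D\<close>.

  Instead of contracting paths, \<open>sum_extensions\<close> decides for one dead end of \<open>T\<close> after the other
  which arc, if any, leaves it. The fact that makes this work is that, among all
  possible heads of a new arc leaving a dead end, exactly one closes a cycle, namely the start of
  the path that ends there (\<open>ex1_path_start\<close>, \<open>sum_close_path\<close>).
\<close>

section \<open>Cycles of partial injections\<close>

definition partial_injections :: "'a set \<Rightarrow> 'a rel set" where
  "partial_injections V = {S. S \<subseteq> V \<times> V \<and> inj_on fst S \<and> inj_on snd S}"

text \<open>
  In a partial injection the vertices reachable from a cyclic vertex are exactly those of its cycle,
  so these classes are the vertex sets of the cycles. Transitive closures replace walks here
  because the effect of one additional arc on them is an explicit formula.
\<close>

definition cycle_classes :: "'a rel \<Rightarrow> 'a set set" where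
  "cycle_classes S = {S\<^sup>* `` {w} | w. (w, w) \<in> S\<^sup>+}"

lemma inj_on_fst_iff_single_valued: "inj_on fst S \<longleftrightarrow> single_valued S"
  by (fastforce simp: inj_on_def single_valued_def)

lemma inj_on_snd_iff_single_valued: "inj_on snd S \<longleftrightarrow> single_valued (S\<inverse>)"
  by (fastforce simp: inj_on_def single_valued_def)

lemma partial_injection_unique_head:
  "S \<in> partial_injections V \<Longrightarrow> (x, y) \<in> S \<Longrightarrow> (x, z) \<in> S \<Longrightarrow> y = z"
  by (auto simp: partial_injections_def inj_on_fst_iff_single_valued dest: single_valuedD)

lemma partial_injection_unique_tail:
  "S \<in> partial_injections V \<Longrightarrow> (y, x) \<in> S \<Longrightarrow> (z, x) \<in> S \<Longrightarrow> y = z"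
  by (auto simp: partial_injections_def inj_on_snd_iff_single_valued dest: single_valuedD)

lemma finite_partial_injections: "finite V \<Longrightarrow> finite (partial_injections V)"
  by (rule finite_subset[of _ "Pow (V \<times> V)"]) (auto simp: partial_injections_def)

lemma partial_injection_finite: "finite V \<Longrightarrow> S \<in> partial_injections V \<Longrightarrow> finite S"
  by (auto simp: partial_injections_def intro: finite_subset[of _ "V \<times> V"])

lemma partial_injection_Domain:
  "S \<in> partial_injections V \<Longrightarrow> Domain S \<subseteq> V"
  "S \<in> partial_injections V \<Longrightarrow> Range S \<subseteq> V"
  by (auto simp: partial_injections_def)

lemma card_Domain_partial_injection:
  "S \<in> partial_injections V \<Longrightarrow> card (Domain S) = card S"
  by (simp add: partial_injections_def Domain_fst card_image)

lemma card_Range_partial_injection: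
  "S \<in> partial_injections V \<Longrightarrow> card (Range S) = card S"
  by (simp add: partial_injections_def Range_snd card_image)

lemma partial_injection_insert:
  assumes "S \<in> partial_injections V" "v \<in> V - Domain S" "u \<in> V - Range S"
  shows "insert (v, u) S \<in> partial_injections V"
  using assms by (force simp: partial_injections_def inj_on_def)

text \<open>Without branching, a walk that starts on a cycle can never leave it.\<close>

lemma cyclic_returns:
  assumes r: "single_valued r" and w: "(w, w) \<in> r\<^sup>+" and v: "(w, v) \<in> r\<^sup>*"
  shows "(v, w) \<in> r\<^sup>*"
  using v
proof (induction rule: rtrancl_induct)
  case base
  show ?case by simp
next
  case (step y z)
  have "(y, w) \<in> r\<^sup>+"
    using step.IH w by (meson rtrancl_trancl_trancl)
  then obtain z' where "(y, z') \<in> r" "(z', w) \<in> r\<^sup>*"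
    by (meson tranclD)
  with r step.hyps show ?case by (auto dest: single_valuedD)
qed

lemma finite_cycle_classes:
  assumes "finite S" shows "finite (cycle_classes S)"
proof -
  have "cycle_classes S \<subseteq> (\<lambda>w. S\<^sup>* `` {w}) ` Domain S"
    by (auto simp: cycle_classes_def dest!: tranclD)
  then show ?thesis by (rule finite_subset) (simp add: assms finite_Domain)
qed

lemma cyclic_avoids_dead_end:
  assumes r: "single_valued r" and w: "(w, w) \<in> r\<^sup>+" and v: "v \<notin> Domain r"
  shows "(w, v) \<notin> r\<^sup>*"
proof
  assume "(w, v) \<in> r\<^sup>*"
  then have "(v, w) \<in> r\<^sup>*" by (rule cyclic_returns[OF r w])
  with w have "(v, w) \<in> r\<^sup>+" by (meson rtrancl_trancl_trancl)
  with v show False by (meson DomainI tranclD)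
qed

text \<open>
  Joining the dead end \<open>v\<close> of one path to the start of another path merges the two paths. No
  new vertex becomes cyclic, and the old cycles never reach \<open>v\<close>, so their classes do not grow.
\<close>

lemma cycle_classes_insert_open:
  assumes r: "single_valued r" and v: "v \<notin> Domain r" and no: "(u, v) \<notin> r\<^sup>*"
  shows "cycle_classes (insert (v, u) r) = cycle_classes r"
proof -
  have cyc: "(w, w) \<in> (insert (v, u) r)\<^sup>+ \<longleftrightarrow> (w, w) \<in> r\<^sup>+" for w
    using no by (auto simp: trancl_insert intro: rtrancl_trans)
  have "(insert (v, u) r)\<^sup>* `` {w} = r\<^sup>* `` {w}" if w: "(w, w) \<in> r\<^sup>+" for w
    using cyclic_avoids_dead_end[OF r w v] by (auto simp: rtrancl_insert)
  then show ?thesis unfolding cycle_classes_def cyc by blast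
qed

text \<open>
  Joining the dead end of a path to the start \<open>u\<close> of the same path makes precisely the vertices of
  that path cyclic. They form one class, which is new because \<open>u\<close> had no incoming arc.
\<close>

lemma cycle_classes_insert_close:
  assumes r: "single_valued r" and v: "v \<notin> Domain r" and u: "u \<notin> Range r"
    and uv: "(u, v) \<in> r\<^sup>*"
  shows "cycle_classes (insert (v, u) r) = insert (r\<^sup>* `` {u}) (cycle_classes r)"
    and "r\<^sup>* `` {u} \<notin> cycle_classes r"
proof -
  let ?r = "insert (v, u) r"
  have old: "?r\<^sup>* `` {w} = r\<^sup>* `` {w}" if "(w, w) \<in> r\<^sup>+" for w
    using cyclic_avoids_dead_end[OF r that v] by (auto simp: rtrancl_insert)
  have new: "?r\<^sup>* `` {w} = r\<^sup>* `` {u}" if "(u, w) \<in> r\<^sup>*" "(w, v) \<in> r\<^sup>*" for w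
    using that by (auto simp: rtrancl_insert)
  have "(w, w) \<in> ?r\<^sup>+ \<longleftrightarrow> (w, w) \<in> r\<^sup>+ \<or> (u, w) \<in> r\<^sup>* \<and> (w, v) \<in> r\<^sup>*" for w
    by (auto simp: trancl_insert)
  then have "cycle_classes ?r = {?r\<^sup>* `` {w} | w. (w, w) \<in> r\<^sup>+}
      \<union> {?r\<^sup>* `` {w} | w. (u, w) \<in> r\<^sup>* \<and> (w, v) \<in> r\<^sup>*}"
    unfolding cycle_classes_def by blast
  also have "{?r\<^sup>* `` {w} | w. (w, w) \<in> r\<^sup>+} = cycle_classes r"
    unfolding cycle_classes_def using old by blast
  also have "{?r\<^sup>* `` {w} | w. (u, w) \<in> r\<^sup>* \<and> (w, v) \<in> r\<^sup>*} = {r\<^sup>* `` {u}}"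
    using new uv by blast
  finally show "cycle_classes ?r = insert (r\<^sup>* `` {u}) (cycle_classes r)" by simp
  show "r\<^sup>* `` {u} \<notin> cycle_classes r"
  proof
    assume "r\<^sup>* `` {u} \<in> cycle_classes r"
    then obtain w where w: "(w, w) \<in> r\<^sup>+" "r\<^sup>* `` {u} = r\<^sup>* `` {w}"
      by (auto simp: cycle_classes_def)
    then have "(w, u) \<in> r\<^sup>*" by blast
    with u have "w = u" by (metis RangeI rtranclE)
    with w u show False by (meson RangeI tranclD2)
  qed
qed

text \<open>
  Existence is a counting argument: if every vertex of the finite set \<open>B\<close> of vertices that reach \<open>v\<close>
  had a predecessor, then taking predecessors would be an injection of \<open>B\<close> into itself, hence onto,
  and \<open>v\<close> would have a successor. Uniqueness holds since walking backwards from \<open>v\<close> never branches.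
\<close>

lemma ex1_path_start:
  assumes V: "finite V" and S: "S \<in> partial_injections V" and v: "v \<in> V - Domain S"
  shows "\<exists>!u. u \<in> V - Range S \<and> (u, v) \<in> S\<^sup>*"
proof (rule ex_ex1I)
  show "\<exists>u. u \<in> V - Range S \<and> (u, v) \<in> S\<^sup>*"
  proof (rule ccontr)
    assume none: "\<not> ?thesis"
    define B where "B = {u. (u, v) \<in> S\<^sup>*}"
    define A where "A = {e \<in> S. snd e \<in> B}"
    have B_V: "B \<subseteq> V"
      unfolding B_def using v partial_injection_Domain(1)[OF S] by (blast elim: converse_rtranclE)
    have B_Range: "B \<subseteq> Range S"
      using none B_V by (auto simp: B_def)
    have fin: "finite B" using B_V V by (rule finite_subset)
    have inj: "inj_on fst A" "inj_on snd A"
      using S by (auto simp: partial_injections_def A_def inj_on_def)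
    have "snd ` A = B" using B_Range by (force simp: A_def)
    then have "card A = card B" using inj by (metis card_image)
    moreover have "fst ` A \<subseteq> B"
      by (auto simp: A_def B_def intro: converse_rtrancl_into_rtrancl)
    ultimately have "fst ` A = B"
      using fin inj by (metis card_image card_subset_eq)
    then have "v \<in> fst ` A" by (simp add: B_def)
    with v show False by (auto simp: A_def)
  qed
next
  have sv: "single_valued (S\<inverse>)"
    using S by (simp add: partial_injections_def inj_on_snd_iff_single_valued)
  fix u u'
  assume u: "u \<in> V - Range S \<and> (u, v) \<in> S\<^sup>*" and u': "u' \<in> V - Range S \<and> (u', v) \<in> S\<^sup>*"
  then have "(u, u') \<in> (S\<inverse>)\<^sup>* \<or> (u', u) \<in> (S\<inverse>)\<^sup>*"
    by (intro single_valued_confluent[OF sv, of v]) (auto simp: rtrancl_converse)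
  then have "(u, u') \<in> S\<^sup>* \<or> (u', u) \<in> S\<^sup>*" by (auto simp: rtrancl_converse)
  then show "u = u'" using u u' by (metis DiffE RangeI rtranclE)
qed

section \<open>Blocks of path-cycle covers\<close>

context
  fixes D :: "'a pair_pre_digraph" and S :: "'a rel"
  assumes S: "S \<in> partial_injections (pverts D)"
begin

interpretation G: pair_wf_digraph "spanning_subgraph D S"
  using S by unfold_locales (auto simp: spanning_subgraph_def partial_injections_def)

lemma verts_arcs [simp]:
  "pverts (spanning_subgraph D S) = pverts D" "parcs (spanning_subgraph D S) = S"
  by (simp_all add: spanning_subgraph_def)

lemma awalk_rtrancl: "G.awalk u p v \<Longrightarrow> (u, v) \<in> S\<^sup>*"
  by (induction p arbitrary: u)
    (auto simp: G.awalk_simps intro: converse_rtrancl_into_rtrancl)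

lemma rtrancl_apath:
  assumes "(u, v) \<in> S\<^sup>*" "u \<in> pverts D"
  shows "\<exists>p. G.apath u p v"
proof -
  have "\<exists>p. G.awalk u p v"
    using assms
  proof (induction rule: converse_rtrancl_induct)
    case base
    then show ?case by (auto intro!: exI[of _ "[]"] simp: G.awalk_simps)
  next
    case (step x y)
    then obtain p where "G.awalk y p v"
      using partial_injection_Domain(2)[OF S] by blast
    with step show ?case by (auto intro!: exI[of _ "(x, y) # p"] simp: G.awalk_simps)
  qed
  then show ?thesis
    using G.reachable_apath G.reachable_awalk by blast
qed

text \<open>
  The condition on incident arcs makes the vertex set of the walk closed under \<open>S\<close> in both
  directions, so that it contains everything reachable from \<open>u\<close> and everything that reaches \<open>v\<close>.
\<close>

lemma block_eq:
  assumes p: "G.awalk u p v"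
    and closed: "incident_arcs S (set (pawalk_verts u p)) = set p"
  shows "set (pawalk_verts u p) = S\<^sup>* `` {u}"
    and "set (pawalk_verts u p) = {x. (x, v) \<in> S\<^sup>*}"
proof -
  let ?B = "set (pawalk_verts u p)"
  have step: "x \<in> ?B \<longleftrightarrow> y \<in> ?B" if "(x, y) \<in> S" for x y
    using that closed G.awalk_verts_arc1[of "(x, y)" p u] G.awalk_verts_arc2[OF p, of "(x, y)"]
    by (force simp: incident_arcs_def)
  have steps: "x \<in> ?B \<longleftrightarrow> y \<in> ?B" if "(x, y) \<in> S\<^sup>*" for x y
    using that by (induction rule: rtrancl_induct) (auto simp: step)
  have ends: "u \<in> ?B" "v \<in> ?B"
    using G.hd_in_awalk_verts(1)[OF p] G.awlast_of_awalk[OF p]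
      last_in_set[OF G.awalk_verts_non_Nil[of u p]] by (auto simp: NOMATCH_def)
  have "(u, x) \<in> S\<^sup>* \<and> (x, v) \<in> S\<^sup>*" if "x \<in> ?B" for x
    using G.awalk_decomp[OF p that] awalk_rtrancl by blast
  then show "?B = S\<^sup>* `` {u}" "?B = {x. (x, v) \<in> S\<^sup>*}"
    using steps ends by blast+
qed

text \<open>
  This closure condition only has to be checked at the two ends of a walk: each vertex of the
  walk but the last is the tail of one of its arcs, and each but the first is the head of one, so
  injectivity leaves no room for further arcs there.
\<close>

lemma incident_arcs_awalk:
  assumes p: "G.awalk u p v"
    and v: "v \<in> Domain S \<Longrightarrow> v \<in> fst ` set p"
    and u: "u \<in> Range S \<Longrightarrow> u \<in> snd ` set p"
  shows "incident_arcs S (set (pawalk_verts u p)) = set p"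
proof -
  let ?B = "set (pawalk_verts u p)"
  have pS: "set p \<subseteq> S" using p by (auto simp: G.awalk_def)
  have "?B \<subseteq> insert v (fst ` set p)"
    using G.awalk_verts_conv[of u p] G.awlast_of_awalk[OF p] by (auto simp: NOMATCH_def)
  moreover have "?B \<subseteq> insert u (snd ` set p)"
    using G.awalk_verts_conv'[of u p v] p by (auto simp: G.awalk_def G.cas_simp split: if_splits)
  ultimately have arc: "e \<in> set p" if "e \<in> S" "fst e \<in> ?B \<or> snd e \<in> ?B" for e
    using that v u S pS unfolding partial_injections_def inj_on_def
    by (smt (verit, ccfv_threshold) Domain_fst Range_snd image_iff insertE mem_Collect_eq subset_iff)
  have "fst e \<in> ?B" if "e \<in> set p" for e
    using that by (rule G.awalk_verts_arc1)
  with arc pS show ?thesis by (auto simp: incident_arcs_def)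
qed

lemma cycle_blocks_eq: "cycle_blocks D S = cycle_classes S"
proof (intro equalityI subsetI)
  fix B assume "B \<in> cycle_blocks D S"
  then obtain u p where B: "B = set (pawalk_verts u p)" and p: "G.awalk u p u" "G.cycle p"
    and closed: "incident_arcs S (set (pawalk_verts u p)) = set p"
    by (auto simp: cycle_blocks_def)
  from p have "p \<noteq> []" by (auto simp: G.cycle_def)
  with p(1) obtain e q where "p = e # q" "e \<in> S" "fst e = u" "G.awalk (snd e) q u"
    by (cases p) (auto simp: G.awalk_simps)
  then have "(u, u) \<in> S\<^sup>+"
    using awalk_rtrancl by (metis prod.collapse rtrancl_into_trancl2)
  then show "B \<in> cycle_classes S"
    using block_eq(1)[OF p(1) closed] B by (auto simp: cycle_classes_def)
next
  fix B assume "B \<in> cycle_classes S"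
  then obtain u where B: "B = S\<^sup>* `` {u}" and u: "(u, u) \<in> S\<^sup>+"
    by (auto simp: cycle_classes_def)
  from u obtain w where w: "(u, w) \<in> S\<^sup>*" "(w, u) \<in> S" by (meson tranclD2)
  have "u \<in> pverts D" using partial_injection_Domain(2)[OF S] w by blast
  then obtain q where q: "G.apath u q w" using rtrancl_apath w by blast
  \<comment> \<open>A closed walk is a cycle if its vertices after the first are distinct. With the closing arc
    in front, these are the vertices of the path \<open>q\<close>.\<close>
  define p where "p = (w, u) # q"
  have p: "G.awalk w p w"
    using q w by (simp add: p_def G.awalk_simps G.apath_def)
  have cyc: "G.cycle p"
    using p q unfolding G.cycle_def p_def by (auto simp: G.apath_def)
  have closed: "incident_arcs S (set (pawalk_verts w p)) = set p"
  proof (rule incident_arcs_awalk[OF p])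
    show "w \<in> fst ` set p" by (simp add: p_def)
    show "w \<in> snd ` set p"
    proof (cases q rule: rev_cases)
      case Nil
      then show ?thesis using q by (simp add: p_def G.apath_simps)
    next
      case (snoc q' e)
      then show ?thesis using q G.awalk_verts_conv[of u q] G.awlast_of_awalk[of u q w]
        by (auto simp: p_def G.apath_def NOMATCH_def)
    qed
  qed
  have "set (pawalk_verts w p) = S\<^sup>* `` {w}"
    by (rule block_eq[OF p closed])
  also have "\<dots> = B"
    using w B by (auto intro: rtrancl_trans converse_rtrancl_into_rtrancl)
  finally show "B \<in> cycle_blocks D S"
    unfolding cycle_blocks_def using p cyc closed by blast
qed

text \<open>A path is determined by its final vertex, as the set of all vertices that lead there.\<close>

lemma path_blocks_eq:
  assumes V: "finite (pverts D)"
  shows "path_blocks D S = (\<lambda>v. {x. (x, v) \<in> S\<^sup>*}) ` (pverts D - Domain S)"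
proof (intro equalityI subsetI)
  fix B assume "B \<in> path_blocks D S"
  then obtain u p v where B: "B = set (pawalk_verts u p)" and p: "G.apath u p v"
    and closed: "incident_arcs S (set (pawalk_verts u p)) = set p"
    by (auto simp: path_blocks_def)
  then have w: "G.awalk u p v" and dist: "distinct (pawalk_verts u p)"
    by (auto simp: G.apath_def)
  have "v \<notin> Domain S"
  proof
    assume "v \<in> Domain S"
    then obtain x where x: "(v, x) \<in> S" by blast
    moreover have v: "last (pawalk_verts u p) = v"
      using G.awlast_of_awalk[OF w] by (simp add: NOMATCH_def)
    then have "v \<in> set (pawalk_verts u p)"
      using G.awalk_verts_non_Nil last_in_set by metis
    ultimately have "(v, x) \<in> incident_arcs S (set (pawalk_verts u p))"
      by (simp add: incident_arcs_def)
    then have "(v, x) \<in> set p" by (simp only: closed)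
    then have "v \<in> set (map fst p)" "p \<noteq> []" by force+
    with v dist show False
      by (auto simp: G.awalk_verts_conv)
  qed
  moreover have "v \<in> pverts D" using G.awalk_last_in_verts[OF w] by simp
  ultimately show "B \<in> (\<lambda>v. {x. (x, v) \<in> S\<^sup>*}) ` (pverts D - Domain S)"
    using B block_eq(2)[OF w closed] by blast
next
  fix B assume "B \<in> (\<lambda>v. {x. (x, v) \<in> S\<^sup>*}) ` (pverts D - Domain S)"
  then obtain v where v: "v \<in> pverts D - Domain S" and B: "B = {x. (x, v) \<in> S\<^sup>*}"
    by blast
  obtain u where u: "u \<in> pverts D - Range S" "(u, v) \<in> S\<^sup>*"
    using ex1_path_start[OF V S v] by blast
  then obtain p where p: "G.apath u p v" using rtrancl_apath by blast
  then have w: "G.awalk u p v" by (simp add: G.apath_def)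
  have closed: "incident_arcs S (set (pawalk_verts u p)) = set p"
    by (rule incident_arcs_awalk[OF w]) (use u v in auto)
  show "B \<in> path_blocks D S"
    unfolding path_blocks_def B using block_eq(2)[OF w closed] p closed by blast
qed

lemma card_path_blocks:
  assumes V: "finite (pverts D)"
  shows "card (path_blocks D S) = card (pverts D) - card S"
proof -
  have "inj_on (\<lambda>v. {x. (x, v) \<in> S\<^sup>*}) (pverts D - Domain S)"
  proof (rule inj_onI)
    fix v v'
    assume v: "v \<in> pverts D - Domain S" and eq: "{x. (x, v) \<in> S\<^sup>*} = {x. (x, v') \<in> S\<^sup>*}"
    from eq have "(v, v') \<in> S\<^sup>*" by blast
    with v show "v = v'" by (metis DiffE DomainI converse_rtranclE)
  qed
  then have "card (path_blocks D S) = card (pverts D - Domain S)"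
    by (simp add: path_blocks_eq[OF V] card_image)
  also have "\<dots> = card (pverts D) - card S"
    using V partial_injection_Domain[OF S] card_Domain_partial_injection[OF S]
    by (simp add: card_Diff_subset finite_subset)
  finally show ?thesis .
qed

end

section \<open>Summing over the extensions of a partial injection\<close>

text \<open>
  Among the \<open>|V| - |T|\<close> possible heads \<open>u\<close>, the start of the path ending in \<open>v\<close> creates a cycle and
  each of the others merges two paths.
\<close>

lemma sum_close_path:
  fixes y :: "'b :: comm_ring_1"
  assumes V: "finite V" and T: "T \<in> partial_injections V" and v: "v \<in> V - Domain T"
  shows "(\<Sum>u \<in> V - Range T. y ^ card (cycle_classes (insert (v, u) T)))
       = y ^ card (cycle_classes T) * (y + of_nat (card V - card T - 1))"
proof -
  have sv: "single_valued T"
    using T by (simp add: partial_injections_def inj_on_fst_iff_single_valued)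
  have finT: "finite (cycle_classes T)"
    by (rule finite_cycle_classes[OF partial_injection_finite[OF V T]])
  obtain u0 where u0: "u0 \<in> V - Range T" "(u0, v) \<in> T\<^sup>*"
    and uniq: "\<And>u. u \<in> V - Range T \<Longrightarrow> (u, v) \<in> T\<^sup>* \<Longrightarrow> u = u0"
    using ex1_path_start[OF V T v] by blast
  have close: "card (cycle_classes (insert (v, u0) T)) = Suc (card (cycle_classes T))"
    using cycle_classes_insert_close[OF sv, of v u0] v u0 finT by simp
  have "(\<Sum>u \<in> V - Range T. y ^ card (cycle_classes (insert (v, u) T)))
      = y ^ card (cycle_classes (insert (v, u0) T))
        + (\<Sum>u \<in> V - Range T - {u0}. y ^ card (cycle_classes (insert (v, u) T)))"
    using V u0 by (simp add: sum.remove)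
  also have "(\<Sum>u \<in> V - Range T - {u0}. y ^ card (cycle_classes (insert (v, u) T)))
      = (\<Sum>u \<in> V - Range T - {u0}. y ^ card (cycle_classes T))"
    by (rule sum.cong[OF refl]) (subst cycle_classes_insert_open[OF sv], use uniq v in auto)
  also have "card (V - Range T - {u0}) = card V - card T - 1"
    using V u0 partial_injection_Domain[OF T] card_Range_partial_injection[OF T]
    by (simp add: card_Diff_subset finite_subset)
  then have "(\<Sum>u \<in> V - Range T - {u0}. y ^ card (cycle_classes T))
      = of_nat (card V - card T - 1) * y ^ card (cycle_classes T)"
    by simp
  finally show ?thesis by (simp add: close algebra_simps)
qed

text \<open>
  Restricting the tails of the additional arcs to \<open>A\<close> is what makes an induction possible: a dead
  end that has been decided to stay one leaves \<open>A\<close> although it remains a dead end of \<open>T\<close>.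
\<close>

definition extensions :: "'a set \<Rightarrow> 'a rel \<Rightarrow> 'a set \<Rightarrow> 'a rel set" where
  "extensions V T A = {S \<in> partial_injections V. T \<subseteq> S \<and> Domain S \<subseteq> Domain T \<union> A}"

lemma extensions_empty:
  assumes "T \<in> partial_injections V" shows "extensions V T {} = {T}"
proof -
  have "S = T" if S: "S \<in> partial_injections V" "T \<subseteq> S" "Domain S \<subseteq> Domain T" for S
  proof (intro equalityI subrelI)
    fix a b assume ab: "(a, b) \<in> S"
    with S(3) obtain c where c: "(a, c) \<in> T" by blast
    with S(2) have "c = b" using partial_injection_unique_head[OF S(1) _ ab] by blast
    with c show "(a, b) \<in> T" by simp
  qed (use S(2) in blast)
  with assms show ?thesis
    by (auto simp: extensions_def)
qed

text \<open>Either \<open>v\<close> remains a dead end, or the arc leaving it is added to \<open>T\<close>.\<close>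

lemma extensions_insert:
  assumes T: "T \<in> partial_injections V" and v: "v \<in> V - Domain T"
  shows "extensions V T (insert v A)
       = {S \<in> extensions V T (insert v A). v \<notin> Domain S}
         \<union> (\<Union>u \<in> V - Range T. extensions V (insert (v, u) T) A)"
proof (intro equalityI subsetI)
  fix S assume S: "S \<in> extensions V T (insert v A)"
  show "S \<in> {S \<in> extensions V T (insert v A). v \<notin> Domain S}
         \<union> (\<Union>u \<in> V - Range T. extensions V (insert (v, u) T) A)"
  proof (cases "v \<in> Domain S")
    case True
    then obtain u where u: "(v, u) \<in> S" by blast
    have "u \<notin> Range T"
    proof
      assume "u \<in> Range T"
      then obtain x where "(x, u) \<in> T" by blast
      with S u have "x = v"
        by (auto simp: extensions_def dest: partial_injection_unique_tail)
      with \<open>(x, u) \<in> T\<close> v show False by blast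
    qed
    moreover have "u \<in> V" using S u by (auto simp: extensions_def partial_injections_def)
    moreover have "S \<in> extensions V (insert (v, u) T) A"
      using S u by (auto simp: extensions_def)
    ultimately show ?thesis by blast
  qed (use S in blast)
qed (auto simp: extensions_def)

lemma extensions_insert_avoid:
  assumes "v \<notin> Domain T" "v \<notin> A"
  shows "{S \<in> extensions V T (insert v A). v \<notin> Domain S} = extensions V T A"
  using assms by (auto simp: extensions_def)

lemma falling_factorial_Suc:
  "falling_factorial x (Suc n) = falling_factorial x n * (x - of_nat n)"
  by (simp add: falling_factorial_def)

text \<open>
  Write \<open>k = |V| - |T|\<close> and \<open>a = |A|\<close>, and call the right-hand side without \<open>y ^ c(T)\<close> \<open>G a k\<close>. Deciding
  on the arc leaving one element of \<open>A\<close> gives the recurrence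
  \<open>G (a + 1) k = G a k + (y + k - 1) * G a (k - 1)\<close>, where the factor is that of
  \<open>sum_close_path\<close>. The product formula satisfies it: with \<open>n = k - 1 - a\<close>, the two terms share the
  factor \<open>falling_factorial x n * (\<Prod>m<a. x + y + m)\<close>, with cofactors \<open>x - n\<close> and \<open>y + k - 1\<close>
  that add up to \<open>x + y + a\<close>.
\<close>

lemma sum_extensions:
  fixes x y :: "'b :: comm_ring_1"
  assumes V: "finite V" and "A \<subseteq> V - Domain T" and "T \<in> partial_injections V"
  shows "(\<Sum>S \<in> extensions V T A.
            falling_factorial x (card V - card S) * y ^ card (cycle_classes S))
       = y ^ card (cycle_classes T) * falling_factorial x (card V - card T - card A)
         * (\<Prod>m<card A. x + y + of_nat m)"
proof -
  from assms have "finite A" by (meson finite_Diff finite_subset)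
  then show ?thesis
    using assms(2,3)
  proof (induction A arbitrary: T rule: finite_induct)
    case empty
    then show ?case by (simp add: extensions_empty)
  next
    case (insert v A)
    let ?w = "\<lambda>S. falling_factorial x (card V - card S) * y ^ card (cycle_classes S)"
    let ?R = "\<Prod>m<card A. x + y + of_nat m"
    define n where "n = card V - card T - 1 - card A"
    note T = insert.prems(2)
    have v: "v \<in> V - Domain T" using insert.prems by blast
    have finT: "finite T" by (rule partial_injection_finite[OF V T])
    have fin: "finite (extensions V T' B)" for T' B
      using finite_partial_injections[OF V] by (simp add: extensions_def)
    have "card (insert v A) \<le> card (V - Domain T)"
      using V insert.prems by (intro card_mono) auto
    also have "card (V - Domain T) = card V - card T"
      using V partial_injection_Domain[OF T] card_Domain_partial_injection[OF T]
      by (simp add: card_Diff_subset finite_subset)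
    finally have card: "card A + 1 \<le> card V - card T" using insert.hyps by simp
    have T_u: "insert (v, u) T \<in> partial_injections V" if "u \<in> V - Range T" for u
      by (rule partial_injection_insert[OF T v that])
    have "(\<Sum>S \<in> extensions V T (insert v A). ?w S)
        = (\<Sum>S \<in> extensions V T A. ?w S)
          + (\<Sum>S \<in> (\<Union>u \<in> V - Range T. extensions V (insert (v, u) T) A). ?w S)"
    proof (subst extensions_insert[OF T v], subst sum.union_disjoint)
      show "{S \<in> extensions V T (insert v A). v \<notin> Domain S}
          \<inter> (\<Union>u \<in> V - Range T. extensions V (insert (v, u) T) A) = {}"
        by (auto simp: extensions_def)
    qed (use V fin v insert.hyps in \<open>simp_all add: extensions_insert_avoid\<close>)
    also have "(\<Sum>S \<in> extensions V T A. ?w S)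
        = y ^ card (cycle_classes T) * falling_factorial x (Suc n) * ?R"
    proof -
      have "card V - card T - card A = Suc n" using card by (simp add: n_def)
      with insert.IH[OF _ T] insert.prems show ?thesis by simp
    qed
    also have "(\<Sum>S \<in> (\<Union>u \<in> V - Range T. extensions V (insert (v, u) T) A). ?w S)
        = (\<Sum>u \<in> V - Range T. \<Sum>S \<in> extensions V (insert (v, u) T) A. ?w S)"
    proof (rule sum.UNION_disjoint)
      have "u = u'" if "S \<in> extensions V (insert (v, u) T) A"
        "S \<in> extensions V (insert (v, u') T) A" for S u u'
        using that by (auto simp: extensions_def dest: partial_injection_unique_head)
      then show "\<forall>u \<in> V - Range T. \<forall>u' \<in> V - Range T. u \<noteq> u' \<longrightarrow>
          extensions V (insert (v, u) T) A \<inter> extensions V (insert (v, u') T) A = {}"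
        by blast
    qed (use V fin in auto)
    also have "\<dots> = (\<Sum>u \<in> V - Range T. y ^ card (cycle_classes (insert (v, u) T))
        * falling_factorial x n * ?R)"
    proof (rule sum.cong[OF refl])
      fix u assume u: "u \<in> V - Range T"
      have "card (insert (v, u) T) = Suc (card T)"
        using v finT by (subst card_insert_disjoint) auto
      then have "card V - card (insert (v, u) T) - card A = n" by (simp add: n_def)
      with insert.IH[OF _ T_u[OF u]] insert.prems insert.hyps
      show "(\<Sum>S \<in> extensions V (insert (v, u) T) A. ?w S)
          = y ^ card (cycle_classes (insert (v, u) T)) * falling_factorial x n * ?R"
        by auto
    qed
    also have "\<dots> = (\<Sum>u \<in> V - Range T. y ^ card (cycle_classes (insert (v, u) T)))
        * falling_factorial x n * ?R"
      by (simp add: sum_distrib_right)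
    also note sum_close_path[OF V T v, of y]
    also have "card V - card T - 1 = n + card A" using card by (simp add: n_def)
    finally have "(\<Sum>S \<in> extensions V T (insert v A). ?w S)
        = y ^ card (cycle_classes T) * falling_factorial x n * (?R * (x + y + of_nat (card A)))"
      by (simp add: falling_factorial_Suc algebra_simps)
    moreover have "card V - card T - card (insert v A) = n"
      using insert.hyps by (simp add: n_def)
    ultimately show ?case using insert.hyps by simp
  qed
qed

text \<open>
  When all dead ends may receive an arc, every superset of \<open>T\<close> is an extension and the falling
  factorial disappears; the remaining rising factorial of \<open>x + y\<close> is a signed falling factorial
  of \<open>- x - y\<close>.
\<close>

lemma sum_supersets:
  fixes x y :: "'b :: comm_ring_1"
  assumes V: "finite V" and T: "T \<in> partial_injections V"
  shows "(\<Sum>S \<in> {S \<in> partial_injections V. T \<subseteq> S}.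
            falling_factorial x (card V - card S) * y ^ card (cycle_classes S))
       = (-1) ^ (card V - card T) * (falling_factorial (- x - y) (card V - card T)
           * y ^ card (cycle_classes T))"
proof -
  have card: "card (V - Domain T) = card V - card T"
    using V partial_injection_Domain[OF T] card_Domain_partial_injection[OF T]
    by (simp add: card_Diff_subset finite_subset)
  have "{S \<in> partial_injections V. T \<subseteq> S} = extensions V T (V - Domain T)"
    using partial_injection_Domain by (fastforce simp: extensions_def)
  moreover have "(\<Prod>m<k. x + y + of_nat m) = (-1) ^ k * falling_factorial (- x - y) k" for k
    by (induction k) (simp_all add: falling_factorial_def algebra_simps)
  ultimately show ?thesis
    using sum_extensions[OF V subset_refl T, of x y]
    by (simp add: card falling_factorial_def mult_ac)
qed

section \<open>Inclusion-exclusion\<close>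

lemma sum_Pow_alternating:
  assumes "finite A"
  shows "(\<Sum>B \<in> Pow A. (-1) ^ card B) = (if A = {} then 1 else 0 :: 'b :: comm_ring_1)"
  using prod_add[OF assms, of "\<lambda>_. -1 :: 'b" "\<lambda>_. 1"] assms by (auto simp: power_0_left)

lemma cover_polynomial_eq:
  assumes "finite (pverts D)" "parcs D \<subseteq> pverts D \<times> pverts D"
  shows "cover_polynomial D = (\<Sum>S \<in> {S \<in> partial_injections (pverts D). S \<subseteq> parcs D}.
     falling_factorial var_i (card (pverts D) - card S) * var_j ^ card (cycle_classes S))"
  unfolding cover_polynomial_def
proof (rule sum.cong)
  show "{S. path_cycle_cover D S} = {S \<in> partial_injections (pverts D). S \<subseteq> parcs D}"
    using assms by (auto simp: path_cycle_cover_def partial_injections_def)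
qed (auto simp: card_path_blocks[OF _ assms(1)] cycle_blocks_eq)

lemma pcompose_power: "pcompose (p ^ n) q = pcompose p q ^ n"
  for p q :: "'b :: comm_ring_1 poly"
  by (induction n) (simp_all add: pcompose_mult pcompose_1)

lemma pcompose_of_nat: "pcompose (of_nat n) q = of_nat n"
  for q :: "'b :: comm_ring_1 poly"
  by (simp add: of_nat_poly)

lemma pcompose_falling_factorial:
  "pcompose (falling_factorial p k) q = falling_factorial (pcompose p q) k"
  by (simp add: falling_factorial_def pcompose_prod pcompose_diff pcompose_of_nat)

theorem corollary1:
  fixes D :: "'a pair_pre_digraph" and d :: nat
  assumes "pair_fin_digraph D"
    and "card (pverts D) = d"
  shows "cover_polynomial (digraph_complement D) =
           (-1) ^ d * pcompose (cover_polynomial D) (- var_i - var_j)"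
proof -
  interpret pair_fin_digraph D by fact
  let ?V = "pverts D" and ?E = "parcs D"
  let ?w = "\<lambda>z S. falling_factorial z (d - card S) * var_j ^ card (cycle_classes S)"
  let ?P = "partial_injections ?V"
  have V: "finite ?V" by (rule pair_finite_verts)
  have E: "?E \<subseteq> ?V \<times> ?V" using wellformed' by auto
  have finP: "finite ?P" by (rule finite_partial_injections[OF V])
  have sub: "T \<in> ?P" if "S \<in> ?P" "T \<subseteq> S" for S T
    using that by (auto simp: partial_injections_def intro: inj_on_subset)
  have "cover_polynomial (digraph_complement D)
      = (\<Sum>S \<in> {S \<in> ?P. S \<subseteq> ?V \<times> ?V - ?E}. ?w var_i S)"
    using V assms(2) by (subst cover_polynomial_eq) (auto simp: digraph_complement_def)
  also have "{S \<in> ?P. S \<subseteq> ?V \<times> ?V - ?E} = {S \<in> ?P. S \<inter> ?E = {}}"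
    by (auto simp: partial_injections_def)
  also have "(\<Sum>S \<in> {S \<in> ?P. S \<inter> ?E = {}}. ?w var_i S)
      = (\<Sum>S \<in> ?P. (\<Sum>T \<in> Pow (S \<inter> ?E). (-1) ^ card T) * ?w var_i S)"
    unfolding sum.inter_filter[OF finP]
  proof (rule sum.cong[OF refl])
    fix S assume "S \<in> ?P"
    then have "finite (S \<inter> ?E)" using partial_injection_finite[OF V] by blast
    then show "(if S \<inter> ?E = {} then ?w var_i S else 0)
        = (\<Sum>T \<in> Pow (S \<inter> ?E). (-1) ^ card T) * ?w var_i S"
      by (simp only: sum_Pow_alternating) simp
  qed
  \<comment> \<open>Subsets of partial injections are partial injections, so \<open>T\<close> ranges over covers of \<open>D\<close>.\<close>
  also have "\<dots> = (\<Sum>S \<in> ?P. \<Sum>T \<in> {T \<in> {T \<in> ?P. T \<subseteq> ?E}. T \<subseteq> S}. (-1) ^ card T * ?w var_i S)"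
    unfolding sum_distrib_right
    by (intro sum.cong refl) (use sub in auto)
  also have "\<dots> = (\<Sum>T \<in> {T \<in> ?P. T \<subseteq> ?E}. \<Sum>S \<in> {S \<in> ?P. T \<subseteq> S}. (-1) ^ card T * ?w var_i S)"
    using finP by (intro sum.swap_restrict) auto
  also have "\<dots> = (\<Sum>T \<in> {T \<in> ?P. T \<subseteq> ?E}. (-1) ^ d * ?w (- var_i - var_j) T)"
  proof (rule sum.cong[OF refl])
    fix T assume "T \<in> {T \<in> ?P. T \<subseteq> ?E}"
    then have T: "T \<in> ?P" by simp
    have "card T \<le> d"
      using card_mono[OF V partial_injection_Domain(1)[OF T]] card_Domain_partial_injection[OF T] assms(2)
      by simp
    then have sign: "(-1) ^ card T * (-1) ^ (d - card T) = ((-1) ^ d :: int poly poly)"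
      by (simp flip: power_add)
    have "(\<Sum>S \<in> {S \<in> ?P. T \<subseteq> S}. (-1) ^ card T * ?w var_i S)
        = (-1) ^ card T * ((-1) ^ (d - card T) * ?w (- var_i - var_j) T)"
      unfolding sum_distrib_left[symmetric]
      using sum_supersets[OF V T, of var_i var_j] assms(2) by simp
    then show "(\<Sum>S \<in> {S \<in> ?P. T \<subseteq> S}. (-1) ^ card T * ?w var_i S)
        = (-1) ^ d * ?w (- var_i - var_j) T"
      by (simp only: sign mult.assoc[symmetric])
  qed
  also have "\<dots> = (-1) ^ d * (\<Sum>T \<in> {T \<in> ?P. T \<subseteq> ?E}. ?w (- var_i - var_j) T)"
    by (simp add: sum_distrib_left)
  also have "(\<Sum>T \<in> {T \<in> ?P. T \<subseteq> ?E}. ?w (- var_i - var_j) T)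
      = pcompose (cover_polynomial D) (- var_i - var_j)"
  proof -
    have i: "pcompose var_i (- var_i - var_j) = - var_i - var_j"
      unfolding var_i_def by (simp add: pcompose_pCons)
    have j: "pcompose var_j (- var_i - var_j) = var_j"
      unfolding var_j_def by (rule pcompose_const)
    show ?thesis
      using V E assms(2)
      by (simp add: cover_polynomial_eq pcompose_sum pcompose_mult pcompose_power
          pcompose_falling_factorial i j)
  qed
  finally show ?thesis .
qed

end
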